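(* Let $K\subseteq\mathbb{R}^n$ be a non-empty closed set and let $T=\sum_{\alpha\in\mathbb{N}_0^n} q_\alpha\cdot\partial^\alpha$ be a linear map $\mathbb{R}[x_1,\dots,x_n]\to\mathbb{R}[x_1,\dots,x_n]$ with $q_\alpha\in\mathbb{R}[x_1,\dots,x_n]$ for all $\alpha\in\mathbb{N}_0^n$. Then the following are equivalent: (i) $T$ is a $K$-positivity preserver, i.e. $T\,\mathrm{Pos}(K)\subseteq\mathrm{Pos}(K)$; (ii) for every $y\in K$ the sequence $(\alpha!\cdot q_\alpha(y))_{\alpha\in\mathbb{N}_0^n}$ is a $(K-y)$-moment sequence, where $K-y=\{x-y : x\in K\}$. Moreover, if one of these equivalent conditions holds, $y\in K$, and $\mu_y$ is a representing measure of the $(K-y)$-moment sequence $(\alpha!\cdot q_\alpha(y))_{\alpha\in\mathbb{N}_0^n}$, then $(T_yf)(y)=\int f(x+y)\,\mathrm{d}\mu_y(x)$ for all $f\in\mathbb{R}[x_1,\dots,x_n]$, where $T_y:=\sum_{\alpha} q_\alpha(y)\cdot\partial^\alpha$.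
   Context: $\mathrm{Pos}(K)=\{f\in\mathbb{R}[x_1,\dots,x_n] : f\geq 0 \text{ on } K\}$. Every linear map $T:\mathbb{R}[x_1,\dots,x_n]\to\mathbb{R}[x_1,\dots,x_n]$ can be written uniquely as $T=\sum_{\alpha\in\mathbb{N}_0^n} q_\alpha\partial^\alpha$ with polynomial coefficients $q_\alpha$ (on any polynomial the sum is finite). For a closed set $L\subseteq\mathbb{R}^n$, a real sequence $s=(s_\alpha)_{\alpha\in\mathbb{N}_0^n}$ is an $L$-moment sequence if there is a (positive Radon) measure $\mu$ on $\mathbb{R}^n$ with $\mathrm{supp}\,\mu\subseteq L$, all monomials $\mu$-integrable, and $s_\alpha=\int x^\alpha\,\mathrm{d}\mu(x)$ for all $\alpha$; such $\mu$ is called a representing measure of $s$. Here $\alpha!=\alpha_1!\cdots\alpha_n!$ and $\partial^\alpha=\partial_1^{\alpha_1}\cdots\partial_n^{\alpha_n}$. *)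

theory Defs
  imports "HOL-Analysis.Analysis" "HOL-Library.Poly_Mapping"
begin

(* Multivariate real polynomials in the variables indexed by the finite type 'n
  (so n = CARD('n)): finitely supported maps from exponent vectors to coefficients.
  Points of R^n are of type real^'n. *)

type_synonym 'n mpoly = "('n \<Rightarrow>\<^sub>0 nat) \<Rightarrow>\<^sub>0 real"

definition mono_eval :: "('n::finite \<Rightarrow>\<^sub>0 nat) \<Rightarrow> real^'n \<Rightarrow> real" where
  "mono_eval \<alpha> x = (\<Prod>i\<in>UNIV. (x $ i) ^ (Poly_Mapping.lookup \<alpha> i))"

definition peval :: "'n::finite mpoly \<Rightarrow> real^'n \<Rightarrow> real" where
  "peval p x = (\<Sum>\<alpha>\<in>Poly_Mapping.keys p. Poly_Mapping.lookup p \<alpha> * mono_eval \<alpha> x)"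

definition mfact :: "('n::finite \<Rightarrow>\<^sub>0 nat) \<Rightarrow> real" where
  "mfact \<alpha> = (\<Prod>i\<in>UNIV. fact (Poly_Mapping.lookup \<alpha> i))"

definition exp_le :: "('n \<Rightarrow>\<^sub>0 nat) \<Rightarrow> ('n \<Rightarrow>\<^sub>0 nat) \<Rightarrow> bool" where
  "exp_le \<alpha> \<beta> \<longleftrightarrow> (\<forall>i. Poly_Mapping.lookup \<alpha> i \<le> Poly_Mapping.lookup \<beta> i)"

definition pderiv_multi :: "('n::finite \<Rightarrow>\<^sub>0 nat) \<Rightarrow> 'n mpoly \<Rightarrow> 'n mpoly" where
  "pderiv_multi \<alpha> f = (\<Sum>\<beta>\<in>Poly_Mapping.keys f. if exp_le \<alpha> \<beta> then
      Poly_Mapping.single (\<beta> - \<alpha>)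
        (Poly_Mapping.lookup f \<beta> * (\<Prod>i\<in>UNIV. fact (Poly_Mapping.lookup \<beta> i) / fact (Poly_Mapping.lookup \<beta> i - Poly_Mapping.lookup \<alpha> i)))
    else 0)"

(* The linear operator T = \<Sum>\<^sub>\<alpha> q\<^sub>\<alpha> \<partial>^\<alpha>; on f only the finitely many \<alpha> below some
  exponent of f contribute. *)
definition diff_op :: "(('n::finite \<Rightarrow>\<^sub>0 nat) \<Rightarrow> 'n mpoly) \<Rightarrow> 'n mpoly \<Rightarrow> 'n mpoly" where
  "diff_op q f = (\<Sum>\<alpha>\<in>{\<alpha>. \<exists>\<beta>\<in>Poly_Mapping.keys f. exp_le \<alpha> \<beta>}. q \<alpha> * pderiv_multi \<alpha> f)"

definition Pos :: "(real^'n::finite) set \<Rightarrow> 'n mpoly set" where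
  "Pos K = {f. \<forall>x\<in>K. 0 \<le> peval f x}"

definition positivity_preserver :: "(real^'n::finite) set \<Rightarrow> ('n mpoly \<Rightarrow> 'n mpoly) \<Rightarrow> bool" where
  "positivity_preserver K T \<longleftrightarrow> T ` Pos K \<subseteq> Pos K"

definition measure_support :: "'a::topological_space measure \<Rightarrow> 'a set" where
  "measure_support \<mu> = {x. \<forall>U. open U \<and> x \<in> U \<longrightarrow> emeasure \<mu> U > 0}"

definition representing_measure ::
  "(real^'n::finite) set \<Rightarrow> (('n \<Rightarrow>\<^sub>0 nat) \<Rightarrow> real) \<Rightarrow> (real^'n) measure \<Rightarrow> bool" where
  "representing_measure L s \<mu> \<longleftrightarrow>
     sets \<mu> = sets borel \<and> measure_support \<mu> \<subseteq> L \<and>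
     (\<forall>\<alpha>. integrable \<mu> (mono_eval \<alpha>)) \<and>
     (\<forall>\<alpha>. s \<alpha> = (\<integral>x. mono_eval \<alpha> x \<partial>\<mu>))"

definition moment_sequence :: "(real^'n::finite) set \<Rightarrow> (('n \<Rightarrow>\<^sub>0 nat) \<Rightarrow> real) \<Rightarrow> bool" where
  "moment_sequence L s \<longleftrightarrow> (\<exists>\<mu>. representing_measure L s \<mu>)"

end

theory Submission
  imports Defs "HOL-Probability.Probability"
begin

text \<open>Writing \<open>s\<^sub>\<alpha> = \<alpha>! q\<^sub>\<alpha>(y)\<close>, the functional \<open>f \<mapsto> (T f)(y)\<close> sends \<open>x\<^sup>\<beta>\<close> to
  \<open>\<Sum>\<^sub>\<alpha> (\<beta> choose \<alpha>) y\<^sup>\<beta>\<^sup>-\<^sup>\<alpha> s\<^sub>\<alpha>\<close>, which is how moments change when a measure with moments \<open>s\<close> is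
  translated by \<open>y\<close>. So \<open>s\<close> is a \<open>(K - y)\<close>-moment sequence iff this functional is integration
  against a measure on \<open>K\<close>, and by Haviland's theorem iff it is nonnegative on \<open>Pos K\<close>.

  Haviland's theorem is reduced to Helly's selection theorem on the real line. Separation in finite
  dimensions gives finitely supported probability measures on \<open>K\<close> whose moments converge to the given
  ones. A continuous surjection of the line onto \<open>\<real>\<^sup>n\<close>, built from Schoenberg's space-filling curve,
  lets one lift them to a tight sequence on the line; the image of a weak limit represents the
  functional, since bounded moments of twice the order make each monomial uniformly integrable.\<close>

section \<open>Shifted sequences and differential operators\<close>

text \<open>The Riesz functional of the sequence \<open>s\<close>: the linear form whose value at
  the monomial with exponent \<alpha> is \<open>s \<alpha>\<close>.\<close>

definition pairing :: "('a \<Rightarrow> real) \<Rightarrow> ('a \<Rightarrow>\<^sub>0 real) \<Rightarrow> real" where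
  "pairing s f = (\<Sum>\<alpha>\<in>Poly_Mapping.keys f. Poly_Mapping.lookup f \<alpha> * s \<alpha>)"

lemma pairing_superset:
  assumes "finite A" "Poly_Mapping.keys f \<subseteq> A"
  shows "pairing s f = (\<Sum>\<alpha>\<in>A. Poly_Mapping.lookup f \<alpha> * s \<alpha>)"
  unfolding pairing_def using assms
  by (intro sum.mono_neutral_left) (auto simp: in_keys_iff)

lemma pairing_zero [simp]: "pairing s 0 = 0"
  by (simp add: pairing_def)

lemma pairing_add: "pairing s (f + g) = pairing s f + pairing s g"
proof -
  let ?A = "Poly_Mapping.keys f \<union> Poly_Mapping.keys g"
  have "pairing s h = (\<Sum>\<alpha>\<in>?A. Poly_Mapping.lookup h \<alpha> * s \<alpha>)" if "h \<in> {f, g, f + g}" for h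
    using that keys_add[of f g] by (intro pairing_superset) auto
  then show ?thesis
    by (simp add: lookup_add algebra_simps sum.distrib)
qed

lemma pairing_single [simp]: "pairing s (Poly_Mapping.single \<alpha> c) = c * s \<alpha>"
  by (simp add: pairing_def)

lemma pairing_sum: "pairing s (sum f A) = (\<Sum>a\<in>A. pairing s (f a))"
  by (induction A rule: infinite_finite_induct) (auto simp: pairing_add)

lemma pairing_scale: "pairing (\<lambda>\<alpha>. c * s \<alpha>) f = c * pairing s f"
  by (simp add: pairing_def sum_distrib_left algebra_simps)

lemma sum_single_keys:
  "(\<Sum>\<alpha>\<in>Poly_Mapping.keys f. Poly_Mapping.single \<alpha> (Poly_Mapping.lookup f \<alpha>)) = f"
  by (rule poly_mapping_eqI)
     (auto simp: lookup_sum lookup_single when_def in_keys_iff sum.delta)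

lemma peval_eq_pairing: "peval p x = pairing (\<lambda>\<alpha>. mono_eval \<alpha> x) p"
  by (simp add: peval_def pairing_def)

lemma mono_eval_0 [simp]: "mono_eval 0 x = 1"
  by (simp add: mono_eval_def)

lemma mono_eval_add: "mono_eval (\<alpha> + \<beta>) x = mono_eval \<alpha> x * mono_eval \<beta> x"
  by (simp add: mono_eval_def lookup_add power_add prod.distrib)

lemma peval_single [simp]: "peval (Poly_Mapping.single \<alpha> c) x = c * mono_eval \<alpha> x"
  by (simp add: peval_eq_pairing)

lemma peval_0 [simp]: "peval 0 x = 0"
  by (simp add: peval_eq_pairing)

lemma peval_add: "peval (f + g) x = peval f x + peval g x"
  by (simp add: peval_eq_pairing pairing_add)

lemma peval_sum: "peval (sum f A) x = (\<Sum>a\<in>A. peval (f a) x)"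
  by (simp add: peval_eq_pairing pairing_sum)

lemma peval_mult: "peval (f * g) x = peval f x * peval g x"
proof -
  have "f * g = (\<Sum>\<alpha>\<in>Poly_Mapping.keys f. \<Sum>\<beta>\<in>Poly_Mapping.keys g.
      Poly_Mapping.single (\<alpha> + \<beta>) (Poly_Mapping.lookup f \<alpha> * Poly_Mapping.lookup g \<beta>))"
    by (subst (1 2) sum_single_keys[symmetric]) (simp add: sum_product mult_single)
  then show ?thesis
    by (simp add: peval_sum mono_eval_add) (simp add: peval_def sum_product algebra_simps)
qed

section \<open>Multi-indices and binomial sums\<close>

lemma exp_le_refl [simp]: "exp_le \<alpha> \<alpha>"
  and exp_le_trans: "exp_le \<alpha> \<beta> \<Longrightarrow> exp_le \<beta> \<gamma> \<Longrightarrow> exp_le \<alpha> \<gamma>"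
  unfolding exp_le_def using le_trans by blast+

text \<open>The index type is finite, so every function on it is finitely supported and the
  exponents below \<beta> form a full box. Sums over them then factor coordinatewise.\<close>

lemma bij_betw_exp_le:
  fixes \<beta> :: "'n::finite \<Rightarrow>\<^sub>0 nat"
  shows "bij_betw Poly_Mapping.lookup {\<gamma>. exp_le \<gamma> \<beta>}
    (PiE UNIV (\<lambda>i. {..Poly_Mapping.lookup \<beta> i}))"
proof (rule bij_betwI[where g = Abs_poly_mapping])
qed (auto simp: exp_le_def)

lemma finite_exp_le [simp]: "finite {\<gamma>. exp_le \<gamma> (\<beta> :: 'n::finite \<Rightarrow>\<^sub>0 nat)}"
  using bij_betw_finite[OF bij_betw_exp_le[of \<beta>]] by (simp add: finite_PiE)

lemma sum_exp_le_prod: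
  fixes F :: "'n::finite \<Rightarrow> nat \<Rightarrow> real"
  shows "(\<Sum>\<gamma> | exp_le \<gamma> \<beta>. \<Prod>i\<in>UNIV. F i (Poly_Mapping.lookup \<gamma> i))
    = (\<Prod>i\<in>UNIV. \<Sum>c\<le>Poly_Mapping.lookup \<beta> i. F i c)"
  using sum.reindex_bij_betw[OF bij_betw_exp_le[of \<beta>], of "\<lambda>g. \<Prod>i\<in>UNIV. F i (g i)"]
  by (simp add: prod_sum_PiE)

text \<open>Rewriting (a choose c)(c choose g) as (a choose g)(a-g choose c-g) leaves a binomial
  expansion of (x + y)^(a-g). This is the one-variable core of composing two translations.\<close>

lemma sum_binomial_convolution:
  fixes x y :: real
  shows "(\<Sum>c\<le>a. of_nat (a choose c) * x ^ (a - c) * (of_nat (c choose g) * y ^ (c - g)))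
    = of_nat (a choose g) * (x + y) ^ (a - g)"
proof (cases "g \<le> a")
  case True
  have "(\<Sum>c\<le>a. of_nat (a choose c) * x ^ (a - c) * (of_nat (c choose g) * y ^ (c - g)))
      = (\<Sum>c\<in>{g..a}. of_nat (a choose c) * x ^ (a - c) * (of_nat (c choose g) * y ^ (c - g)))"
    by (intro sum.mono_neutral_right) auto
  also have "\<dots> = (\<Sum>d\<le>a - g. of_nat (a choose g) * (of_nat ((a - g) choose d) * y ^ d * x ^ (a - g - d)))"
  proof (rule sum.reindex_bij_witness[of _ "\<lambda>d. d + g" "\<lambda>c. c - g"])
    fix c assume c: "c \<in> {g..a}"
    then have "real (a choose c) * real (c choose g) = real (a choose g) * real ((a - g) choose (c - g))"
      unfolding of_nat_mult[symmetric] by (subst choose_mult) auto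
    moreover from c have "a - g - (c - g) = a - c"
      by auto
    ultimately show "of_nat (a choose g) * (of_nat ((a - g) choose (c - g)) * y ^ (c - g) * x ^ (a - g - (c - g)))
        = of_nat (a choose c) * x ^ (a - c) * (of_nat (c choose g) * y ^ (c - g))"
      by (simp add: mult.left_commute mult.commute)
  qed (use True in auto)
  also have "\<dots> = of_nat (a choose g) * (y + x) ^ (a - g)"
    by (simp add: binomial_ring sum_distrib_left)
  finally show ?thesis
    by (simp add: add.commute)
next
  case False
  then have "of_nat (c choose g) = (0::real)" if "c \<le> a" for c
    using that by simp
  then show ?thesis using False by (simp add: sum.neutral)
qed

definition mbinom :: "('n::finite \<Rightarrow>\<^sub>0 nat) \<Rightarrow> ('n \<Rightarrow>\<^sub>0 nat) \<Rightarrow> real" where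
  "mbinom \<beta> \<alpha> = (\<Prod>i\<in>UNIV. of_nat (Poly_Mapping.lookup \<beta> i choose Poly_Mapping.lookup \<alpha> i))"

text \<open>If \<open>s\<close> is the moment sequence of a measure, \<open>shift_seq y s\<close> is the moment sequence of its
  translate by \<open>y\<close>.\<close>

definition shift_seq :: "real^'n::finite \<Rightarrow> (('n \<Rightarrow>\<^sub>0 nat) \<Rightarrow> real) \<Rightarrow> ('n \<Rightarrow>\<^sub>0 nat) \<Rightarrow> real" where
  "shift_seq y s \<beta> = (\<Sum>\<alpha> | exp_le \<alpha> \<beta>. mbinom \<beta> \<alpha> * mono_eval (\<beta> - \<alpha>) y * s \<alpha>)"

text \<open>Allows sums over the exponents below \<beta> to be extended to larger index
  sets.\<close>

lemma mbinom_eq_0: "\<not> exp_le \<alpha> \<beta> \<Longrightarrow> mbinom \<beta> \<alpha> = 0"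
  by (force simp: mbinom_def exp_le_def not_le intro!: binomial_eq_0)

text \<open>The binomial theorem in each coordinate, multiplied out; it is the source of the
  coefficients in \<open>shift_seq\<close>.\<close>

lemma mono_eval_translate: "mono_eval \<beta> (x + y) = shift_seq y (\<lambda>\<alpha>. mono_eval \<alpha> x) \<beta>"
proof -
  have "mono_eval \<beta> (x + y) = (\<Prod>i\<in>UNIV. \<Sum>c\<le>Poly_Mapping.lookup \<beta> i.
      of_nat (Poly_Mapping.lookup \<beta> i choose c) * (x $ i) ^ c * (y $ i) ^ (Poly_Mapping.lookup \<beta> i - c))"
    by (simp add: mono_eval_def binomial_ring)
  also have "\<dots> = shift_seq y (\<lambda>\<alpha>. mono_eval \<alpha> x) \<beta>"
    by (subst sum_exp_le_prod[symmetric])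
       (auto simp: shift_seq_def mbinom_def mono_eval_def lookup_minus prod.distrib algebra_simps
         intro!: sum.cong)
  finally show ?thesis .
qed

text \<open>A monomial with nonzero exponent vanishes at the origin, so only the term with \<alpha>
  = \<beta> survives.\<close>

lemma shift_seq_0 [simp]: "shift_seq 0 s = (s :: ('n::finite \<Rightarrow>\<^sub>0 nat) \<Rightarrow> real)"
proof
  fix \<beta> :: "'n \<Rightarrow>\<^sub>0 nat"
  have "mbinom \<beta> \<alpha> * mono_eval (\<beta> - \<alpha>) 0 = (if \<alpha> = \<beta> then 1 else 0)" if "exp_le \<alpha> \<beta>" for \<alpha>
  proof (cases "\<alpha> = \<beta>")
    case False
    with that obtain i where "Poly_Mapping.lookup \<alpha> i < Poly_Mapping.lookup \<beta> i"
      by (metis exp_le_def le_neq_implies_less poly_mapping_eqI)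
    then show ?thesis
      using False by (auto simp: mono_eval_def lookup_minus intro!: exI[of _ i])
  qed (simp add: mbinom_def)
  then have "shift_seq 0 s \<beta> = (\<Sum>\<alpha> | exp_le \<alpha> \<beta>. if \<alpha> = \<beta> then s \<alpha> else 0)"
    unfolding shift_seq_def by (intro sum.cong) auto
  then show "shift_seq 0 s \<beta> = s \<beta>"
    by (simp add: sum.delta)
qed

text \<open>Makes the shift by -y inverse to the shift by y at the level of sequences, before any
  measure is known to represent them.\<close>

lemma shift_seq_shift_seq: "shift_seq x (shift_seq y s) = shift_seq (x + y) s"
proof
  fix \<alpha>
  have conv: "(\<Sum>\<beta> | exp_le \<beta> \<alpha>. mbinom \<alpha> \<beta> * mono_eval (\<alpha> - \<beta>) x * (mbinom \<beta> \<gamma> * mono_eval (\<beta> - \<gamma>) y))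
      = mbinom \<alpha> \<gamma> * mono_eval (\<alpha> - \<gamma>) (x + y)" for \<gamma>
    using sum_exp_le_prod[of "\<lambda>i c. of_nat (Poly_Mapping.lookup \<alpha> i choose c) * (x $ i) ^ (Poly_Mapping.lookup \<alpha> i - c)
      * (of_nat (c choose Poly_Mapping.lookup \<gamma> i) * (y $ i) ^ (c - Poly_Mapping.lookup \<gamma> i))" \<alpha>]
    by (simp add: sum_binomial_convolution mbinom_def mono_eval_def lookup_minus prod.distrib)
  \<comment> \<open>The inner sum is extended to all \<gamma> below \<alpha>, adding only vanishing
    binomials; its range no longer depends on \<beta>, so the sums can be swapped.\<close>
  have "shift_seq x (shift_seq y s) \<alpha> = (\<Sum>\<beta> | exp_le \<beta> \<alpha>. mbinom \<alpha> \<beta> * mono_eval (\<alpha> - \<beta>) x *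
      (\<Sum>\<gamma> | exp_le \<gamma> \<alpha>. mbinom \<beta> \<gamma> * mono_eval (\<beta> - \<gamma>) y * s \<gamma>))"
    unfolding shift_seq_def
    by (intro sum.cong refl arg_cong[where f = "(*) _"] sum.mono_neutral_left)
       (auto simp: mbinom_eq_0 intro: exp_le_trans)
  also have "\<dots> = (\<Sum>\<gamma> | exp_le \<gamma> \<alpha>. (\<Sum>\<beta> | exp_le \<beta> \<alpha>. mbinom \<alpha> \<beta> * mono_eval (\<alpha> - \<beta>) x *
      (mbinom \<beta> \<gamma> * mono_eval (\<beta> - \<gamma>) y)) * s \<gamma>)"
    by (simp add: sum_distrib_left sum_distrib_right mult.assoc) (rule sum.swap)
  also have "\<dots> = shift_seq (x + y) s \<alpha>"
    by (simp add: conv shift_seq_def)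
  finally show "shift_seq x (shift_seq y s) \<alpha> = shift_seq (x + y) s \<alpha>" .
qed

text \<open>The quotient of \<beta>! by (\<beta>-\<alpha>)! is \<alpha>! times a binomial
  coefficient, which is why \<alpha>! enters the moment sequence.\<close>

lemma peval_pderiv_multi:
  "peval (pderiv_multi \<alpha> f) y =
    mfact \<alpha> * pairing (\<lambda>\<beta>. mbinom \<beta> \<alpha> * mono_eval (\<beta> - \<alpha>) y) f"
proof -
  have "(\<Prod>i\<in>UNIV. fact (Poly_Mapping.lookup \<beta> i) / fact (Poly_Mapping.lookup \<beta> i - Poly_Mapping.lookup \<alpha> i))
      = mfact \<alpha> * mbinom \<beta> \<alpha>" if "exp_le \<alpha> \<beta>" for \<beta>
    unfolding mfact_def mbinom_def prod.distrib[symmetric] using that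
    by (intro prod.cong) (auto simp: exp_le_def binomial_fact)
  then show ?thesis
    by (auto simp: pderiv_multi_def peval_sum pairing_def sum_distrib_left mbinom_eq_0 intro!: sum.cong)
qed

text \<open>Evaluation at \<open>y\<close> sees the coefficients only through the numbers
  \<open>peval (q \<alpha>) y\<close>. Positivity preservation thus becomes, at each
  \<open>y\<close>, a condition on one Riesz functional.\<close>

lemma peval_diff_op:
  "peval (diff_op q f) y = pairing (shift_seq y (\<lambda>\<alpha>. mfact \<alpha> * peval (q \<alpha>) y)) f"
proof -
  let ?A = "{\<alpha>. \<exists>\<beta>\<in>Poly_Mapping.keys f. exp_le \<alpha> \<beta>}"
  have fin: "finite ?A"
    by (rule finite_subset[of _ "\<Union>\<beta>\<in>Poly_Mapping.keys f. {\<alpha>. exp_le \<alpha> \<beta>}"]) auto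
  have "peval (diff_op q f) y = (\<Sum>\<alpha>\<in>?A. \<Sum>\<beta>\<in>Poly_Mapping.keys f.
      Poly_Mapping.lookup f \<beta> * (mbinom \<beta> \<alpha> * mono_eval (\<beta> - \<alpha>) y * (mfact \<alpha> * peval (q \<alpha>) y)))"
    by (simp add: diff_op_def peval_sum peval_mult peval_pderiv_multi pairing_def sum_distrib_left algebra_simps)
  also have "\<dots> = (\<Sum>\<beta>\<in>Poly_Mapping.keys f. Poly_Mapping.lookup f \<beta> *
      (\<Sum>\<alpha>\<in>?A. mbinom \<beta> \<alpha> * mono_eval (\<beta> - \<alpha>) y * (mfact \<alpha> * peval (q \<alpha>) y)))"
    by (subst sum.swap) (simp add: sum_distrib_left)
  also have "\<dots> = pairing (shift_seq y (\<lambda>\<alpha>. mfact \<alpha> * peval (q \<alpha>) y)) f"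
    unfolding pairing_def shift_seq_def
    by (intro sum.cong refl arg_cong[where f = "(*) _"] sum.mono_neutral_right fin)
       (auto simp: mbinom_eq_0)
  finally show ?thesis .
qed

section \<open>Finite-dimensional separation\<close>

text \<open>The separating functional \<open>a\<close> is normal to \<open>V\<close> at the point of its closure nearest to \<open>v\<close>; that point
  is a limit of a distance-minimising sequence, which is Cauchy by the parallelogram law.\<close>

lemma approximate_or_separate:
  fixes V :: "('a \<Rightarrow> real) set" and v :: "'a \<Rightarrow> real"
  assumes S: "finite S" and ne: "V \<noteq> {}"
    and conv: "\<And>u w t. u \<in> V \<Longrightarrow> w \<in> V \<Longrightarrow> 0 \<le> t \<Longrightarrow> t \<le> 1 \<Longrightarrow> (\<lambda>s. (1 - t) * u s + t * w s) \<in> V"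
    and no_sep: "\<And>a b. (\<And>w. w \<in> V \<Longrightarrow> b \<le> (\<Sum>s\<in>S. a s * w s)) \<Longrightarrow> b \<le> (\<Sum>s\<in>S. a s * v s)"
    and \<epsilon>: "\<epsilon> > 0"
  shows "\<exists>w\<in>V. \<forall>s\<in>S. \<bar>w s - v s\<bar> < \<epsilon>"
proof -
  \<comment> \<open>\<open>D\<close> is a squared distance to \<open>v\<close> that sees only the
    coordinates in \<open>S\<close>, so the geometry is finite-dimensional.\<close>
  define D where "D w = (\<Sum>s\<in>S. (w s - v s)\<^sup>2)" for w :: "'a \<Rightarrow> real"
  define \<delta> where "\<delta> = Inf (D ` V)"
  have D_nonneg: "0 \<le> D w" for w
    by (simp add: D_def sum_nonneg)
  have bdd: "bdd_below (D ` V)"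
    using D_nonneg by (intro bdd_belowI[of _ 0]) auto
  have \<delta>_le: "\<delta> \<le> D w" if "w \<in> V" for w
    unfolding \<delta>_def using that by (intro cInf_lower bdd) auto
  have "\<exists>w\<in>V. D w < \<delta> + e" if "e > 0" for e
    using cInf_lessD[of "D ` V" "\<delta> + e"] ne that by (auto simp: \<delta>_def)
  then have "\<forall>k::nat. \<exists>w\<in>V. D w < \<delta> + inverse (real (Suc k))"
    by simp
  then obtain w where w: "\<And>k::nat. w k \<in> V" and wD: "\<And>k. D (w k) < \<delta> + inverse (real (Suc k))"
    by metis
  have para: "(\<Sum>s\<in>S. (w j s - w k s)\<^sup>2) \<le> 2 * inverse (real (Suc j)) + 2 * inverse (real (Suc k))" for j k
  proof -
    \<comment> \<open>The midpoint lies in \<open>V\<close> by convexity, so its squared distance is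
      at least \<delta>; the parallelogram law then bounds the distance of two almost minimal
      points.\<close>
    let ?m = "\<lambda>s. (1 - 1/2) * w j s + 1/2 * w k s"
    have "(\<Sum>s\<in>S. (w j s - w k s)\<^sup>2) = 2 * D (w j) + 2 * D (w k) - 4 * D ?m"
      unfolding D_def sum_distrib_left sum.distrib[symmetric] sum_subtractf[symmetric]
      by (intro sum.cong refl) (simp add: power2_eq_square field_simps)
    moreover have "\<delta> \<le> D ?m"
      by (intro \<delta>_le conv w) auto
    ultimately show ?thesis
      using wD[of j] wD[of k] by linarith
  qed
  have "Cauchy (\<lambda>k. w k s)" if s: "s \<in> S" for s
  proof (rule metric_CauchyI)
    fix e :: real assume e: "e > 0"
    obtain M where M: "inverse (real (Suc M)) < e\<^sup>2 / 4"
      using reals_Archimedean[of "e\<^sup>2 / 4"] e by auto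
    show "\<exists>M. \<forall>m\<ge>M. \<forall>n\<ge>M. dist (w m s) (w n s) < e"
    proof (intro exI allI impI)
      fix m n assume mn: "M \<le> m" "M \<le> n"
      have "(w m s - w n s)\<^sup>2 \<le> (\<Sum>s\<in>S. (w m s - w n s)\<^sup>2)"
        using s S by (intro member_le_sum) auto
      also note para
      also have "2 * inverse (real (Suc m)) + 2 * inverse (real (Suc n))
          \<le> 2 * inverse (real (Suc M)) + 2 * inverse (real (Suc M))"
        using mn by (intro add_mono mult_left_mono le_imp_inverse_le) auto
      also have "\<dots> < e\<^sup>2"
        using M by simp
      finally have "\<bar>w m s - w n s\<bar> < e"
        using e by (intro power2_less_imp_less[of "\<bar>w m s - w n s\<bar>"]) auto
      then show "dist (w m s) (w n s) < e"
        by (simp add: dist_real_def)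
    qed
  qed
  then have "\<forall>s\<in>S. \<exists>l. (\<lambda>k. w k s) \<longlonglongrightarrow> l"
    by (auto simp: Cauchy_convergent_iff convergent_def)
  then obtain l where l: "\<And>s. s \<in> S \<Longrightarrow> (\<lambda>k. w k s) \<longlonglongrightarrow> l s"
    by metis
  define a where "a s = l s - v s" for s
  have Dl: "(\<lambda>k. D (w k)) \<longlonglongrightarrow> (\<Sum>s\<in>S. (a s)\<^sup>2)"
    unfolding D_def a_def by (intro tendsto_intros l)
  moreover have "(\<lambda>k. \<delta> + inverse (real (Suc k))) \<longlonglongrightarrow> \<delta> + 0"
    by (intro tendsto_intros LIMSEQ_inverse_real_of_nat)
  ultimately have a_le: "(\<Sum>s\<in>S. (a s)\<^sup>2) \<le> \<delta>"
    using wD by (intro LIMSEQ_le[of _ _ "\<lambda>k. \<delta> + inverse (real (Suc k))"]) (auto intro: less_imp_le)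
  \<comment> \<open>First-order condition for minimality: a step of size \<open>t\<close> from
    \<open>l\<close> towards \<open>u\<close> cannot bring the squared distance below \<delta>.
    Dividing by \<open>t\<close> and letting it tend to 0 leaves the inner product.\<close>
  have normal: "0 \<le> (\<Sum>s\<in>S. a s * (u s - l s))" if u: "u \<in> V" for u
  proof -
    let ?A = "\<Sum>s\<in>S. a s * (u s - l s)" and ?B = "\<Sum>s\<in>S. (u s - l s)\<^sup>2"
    have quad: "0 \<le> 2 * ?A + t * ?B" if t: "0 < t" "t \<le> 1" for t
    proof -
      \<comment> \<open>The limit \<open>l\<close> need not lie in \<open>V\<close>, so the bound is
        taken at \<open>w k\<close> and passed to the limit.\<close>
      have "(\<lambda>k. D (\<lambda>s. (1 - t) * w k s + t * u s)) \<longlonglongrightarrow> (\<Sum>s\<in>S. ((1 - t) * l s + t * u s - v s)\<^sup>2)"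
        unfolding D_def by (intro tendsto_intros l)
      then have "\<delta> \<le> (\<Sum>s\<in>S. ((1 - t) * l s + t * u s - v s)\<^sup>2)"
        using t by (elim LIMSEQ_le_const) (auto intro!: \<delta>_le conv w u)
      also have "\<dots> = (\<Sum>s\<in>S. (a s)\<^sup>2) + t * (2 * ?A + t * ?B)"
        unfolding sum_distrib_left distrib_left sum.distrib[symmetric]
        by (intro sum.cong refl) (simp add: a_def power2_eq_square algebra_simps)
      finally show ?thesis
        using a_le t by (smt (verit) mult_pos_neg)
    qed
    have "((\<lambda>t. 2 * ?A + t * ?B) \<longlongrightarrow> 2 * ?A + 0 * ?B) (at_right 0)"
      by (intro tendsto_intros)
    moreover have "\<forall>\<^sub>F t in at_right 0. 0 \<le> 2 * ?A + t * ?B"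
      using eventually_at_right_less[of 0] eventually_at_right_real[of 0 1]
      by (auto elim!: eventually_mono intro!: quad)
    ultimately have "0 \<le> 2 * ?A + 0 * ?B"
      by (rule tendsto_lowerbound) simp
    then show ?thesis by simp
  qed
  \<comment> \<open>The half-space bounded by the hyperplane through \<open>l\<close> with normal
    \<open>a\<close> contains \<open>V\<close>, hence also \<open>v\<close>. As \<open>a\<close> is
    \<open>l - v\<close>, its squared norm must vanish.\<close>
  have "(\<Sum>s\<in>S. a s * l s) \<le> (\<Sum>s\<in>S. a s * v s)"
    using normal by (intro no_sep) (simp add: right_diff_distrib sum_subtractf)
  moreover have "(\<Sum>s\<in>S. (a s)\<^sup>2) = (\<Sum>s\<in>S. a s * l s) - (\<Sum>s\<in>S. a s * v s)"
    unfolding sum_subtractf[symmetric]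
    by (intro sum.cong refl) (simp add: a_def power2_eq_square algebra_simps)
  ultimately have "(\<Sum>s\<in>S. (a s)\<^sup>2) \<le> 0"
    by simp
  moreover have "(\<lambda>k. D (w k)) \<longlonglongrightarrow> (\<Sum>s\<in>S. (a s)\<^sup>2)"
    by (rule Dl)
  ultimately have "\<forall>\<^sub>F k in sequentially. D (w k) < \<epsilon>\<^sup>2"
    using \<epsilon> by (intro order_tendstoD) (auto intro: le_less_trans)
  then obtain k where k: "D (w k) < \<epsilon>\<^sup>2"
    by (auto simp: eventually_sequentially)
  have "\<bar>w k s - v s\<bar> < \<epsilon>" if s: "s \<in> S" for s
  proof -
    have "(w k s - v s)\<^sup>2 \<le> D (w k)"
      unfolding D_def using s S by (intro member_le_sum) auto
    then show ?thesis
      using k \<epsilon> by (intro power2_less_imp_less[of "\<bar>w k s - v s\<bar>"]) auto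
  qed
  then show ?thesis
    using w by blast
qed

section \<open>A space-filling curve\<close>

text \<open>Greedy digits: \<open>r k\<close> is the remainder after k digits, rescaled by 2^k. It
  stays in [0,1], also for a = 1, where all digits are 1.\<close>

lemma binary_expansion:
  fixes a :: real
  assumes "0 \<le> a" "a \<le> 1"
  obtains b :: "nat \<Rightarrow> nat" where "\<And>k. b k \<le> 1" "(\<lambda>k. (1/2) ^ Suc k * real (b k)) sums a"
proof -
  define r where "r = rec_nat a (\<lambda>_ r. 2 * r - of_bool (r \<ge> 1/2))"
  define b :: "nat \<Rightarrow> nat" where "b k = of_bool (r k \<ge> 1/2)" for k
  have r_Suc: "r (Suc k) = 2 * r k - real (b k)" for k
    by (simp add: r_def b_def)
  have r: "0 \<le> r k \<and> r k \<le> 1" for k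
    by (induction k) (use assms in \<open>auto simp: r_Suc b_def\<close>, auto simp: r_def)
  have partial: "(\<Sum>k<N. (1/2) ^ Suc k * real (b k)) = a - (1/2) ^ N * r N" for N
    by (induction N) (simp_all add: r_Suc field_simps, simp add: r_def)
  have "(\<lambda>N. (1/2) ^ N * r N) \<longlonglongrightarrow> 0"
  proof (rule Lim_null_comparison)
    show "\<forall>\<^sub>F N in sequentially. norm ((1/2) ^ N * r N) \<le> (1/2) ^ N"
      using r by (intro always_eventually allI) (simp add: abs_mult mult_left_le)
  qed (simp add: LIMSEQ_power_zero)
  then have "(\<lambda>N. a - (1/2) ^ N * r N) \<longlonglongrightarrow> a - 0"
    by (intro tendsto_intros)
  then have "(\<lambda>k. (1/2) ^ Suc k * real (b k)) sums a"
    unfolding sums_def partial by simp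
  then show ?thesis
    by (intro that[of b]) (auto simp: b_def)
qed

text \<open>Clipping a cosine gives a continuous function of period 2 that is 0 on [0,1/3] and 1 on
  [2/3,1], as Schoenberg's construction requires.\<close>

definition plateau :: "real \<Rightarrow> real" where
  "plateau t = max 0 (min 1 (1/2 - cos (pi * t)))"

lemma plateau_bounds: "0 \<le> plateau t" "plateau t \<le> 1"
  by (auto simp: plateau_def)

lemma continuous_on_plateau [continuous_intros]:
  fixes f :: "real \<Rightarrow> real"
  shows "continuous_on A f \<Longrightarrow> continuous_on A (\<lambda>t. plateau (f t))"
  unfolding plateau_def by (intro continuous_intros)

lemma plateau_period: "plateau (2 * real n + t) = plateau t"
proof -
  have "cos (pi * (2 * real n + t)) = cos (2 * real n * pi + pi * t)"
    by (simp add: algebra_simps)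
  also have "\<dots> = cos (pi * t)"
    by (simp add: cos_add cos_2npi sin_2npi)
  finally show ?thesis
    by (simp add: plateau_def)
qed

lemma plateau_eq_0:
  assumes "0 \<le> t" "t \<le> 1/3"
  shows "plateau t = 0"
proof -
  have "cos (pi / 3) \<le> cos (pi * t)"
    using assms by (intro cos_monotone_0_pi_le) (auto simp: field_simps)
  then show ?thesis
    by (simp add: plateau_def cos_60)
qed

lemma plateau_eq_1:
  assumes "2/3 \<le> t" "t \<le> 1"
  shows "plateau t = 1"
proof -
  have "cos (pi * t) \<le> cos (2 * (pi / 3))"
    using assms by (intro cos_monotone_0_pi_le) (auto simp: field_simps)
  also have "\<dots> = - 1/2"
    by (subst cos_double_cos) (simp add: cos_60 power2_eq_square)
  finally show ?thesis
    by (simp add: plateau_def)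
qed

text \<open>Take \<open>t\<close> with ternary digits \<open>2 * b m\<close>. Multiplying by 3^m
  moves digit m to the front, and this digit decides whether the fractional tail \<open>T m\<close>
  lies in the first or the last third of [0,1].\<close>

lemma plateau_ternary:
  fixes b :: "nat \<Rightarrow> nat"
  assumes b: "\<And>m. b m \<le> 1"
  obtains t where "0 \<le> t" "t \<le> 1" "\<And>m. plateau (3 ^ m * t) = real (b m)"
proof -
  define T where "T m = suminf (\<lambda>j. 2 * real (b (j + m)) * (1/3) ^ Suc j)" for m
  have g: "(\<lambda>j. 2 * (1/3 :: real) ^ Suc j) sums 1"
    using sums_mult[OF geometric_sums[of "1/3 :: real"], of "2/3"] by simp
  have le: "2 * real (b (j + m)) * (1/3) ^ Suc j \<le> 2 * (1/3) ^ Suc j" for j m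
    using b[of "j + m"] by (intro mult_right_mono) auto
  have summ: "summable (\<lambda>j. 2 * real (b (j + m)) * (1/3) ^ Suc j)" for m
    using le by (intro summable_comparison_test'[OF sums_summable[OF g], of 0]) auto
  have T0: "0 \<le> T m" for m
    unfolding T_def by (intro suminf_nonneg summ) auto
  have T1: "T m \<le> 1" for m
  proof -
    have "T m \<le> suminf (\<lambda>j. 2 * (1/3 :: real) ^ Suc j)"
      unfolding T_def by (intro suminf_le le summ sums_summable[OF g])
    then show ?thesis
      using sums_unique[OF g] by simp
  qed
  have T_Suc: "3 * T m = 2 * real (b m) + T (Suc m)" for m
  proof -
    have "T m = suminf (\<lambda>j. 2 * real (b (Suc j + m)) * (1/3) ^ Suc (Suc j)) + 2 * real (b m) * (1/3)"
      using suminf_split_head[OF summ, of m] unfolding T_def by simp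
    also have "suminf (\<lambda>j. 2 * real (b (Suc j + m)) * (1/3) ^ Suc (Suc j)) = T (Suc m) * (1/3)"
      unfolding T_def by (subst suminf_mult2[OF summ]) (simp add: mult.assoc)
    finally show ?thesis
      by linarith
  qed
  \<comment> \<open>All digits are 0 or 2, so the part split off is an even integer and is absorbed
    by the period of \<open>plateau\<close>.\<close>
  have ex: "\<exists>N. 3 ^ m * T 0 = 2 * real N + T m" for m
  proof (induction m)
    case (Suc m)
    then obtain N where "3 ^ m * T 0 = 2 * real N + T m"
      by blast
    then have "3 * (3 ^ m * T 0) = 6 * real N + 3 * T m"
      by linarith
    then have "3 ^ Suc m * T 0 = 2 * real (3 * N + b m) + T (Suc m)"
      using T_Suc[of m] by simp
    then show ?case by blast
  qed (auto intro: exI[of _ 0])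
  have "plateau (3 ^ m * T 0) = real (b m)" for m
  proof -
    have "plateau (3 ^ m * T 0) = plateau (T m)"
      using ex[of m] by (auto simp: plateau_period)
    also have "\<dots> = real (b m)"
    proof (cases "b m = 0")
      case True
      then show ?thesis
        using T_Suc[of m] T0[of m] T1[of "Suc m"] by (simp add: plateau_eq_0)
    next
      case False
      with b[of m] have "b m = 1" by simp
      then show ?thesis
        using T_Suc[of m] T1[of m] T0[of "Suc m"] by (simp add: plateau_eq_1)
    qed
    finally show ?thesis .
  qed
  then show ?thesis
    using T0 T1 that by blast
qed

text \<open>Schoenberg's space-filling curve: the binary digits of the coordinates of a point of the cube
  are interleaved into the ternary digits (0 or 2) of the parameter.\<close>

lemma schoenberg_curve:
  obtains \<phi> :: "real \<Rightarrow> real^'n::finite" where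
    "continuous_on UNIV \<phi>" "\<And>n t. \<phi> (2 * real n + t) = \<phi> t"
    "\<And>x. (\<And>i. 0 \<le> x $ i \<and> x $ i \<le> 1) \<Longrightarrow> \<exists>t. 0 \<le> t \<and> t \<le> 1 \<and> \<phi> t = x"
proof -
  define N where "N = CARD('n)"
  have "N > 0"
    by (simp add: N_def)
  obtain e :: "'n \<Rightarrow> nat" where e: "bij_betw e UNIV {0..<N}"
    unfolding N_def using ex_bij_betw_finite_nat[of "UNIV :: 'n set"] by auto
  have e_less: "e i < N" for i
    using e by (auto simp: bij_betw_def)
  \<comment> \<open>Coordinate \<open>i\<close> reads the ternary digits at the positions congruent
    to \<open>e i\<close> modulo \<open>N\<close>.\<close>
  define c where "c i t k = (1/2) ^ Suc k * plateau (3 ^ (N * k + e i) * t)" for i t k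
  define \<phi> :: "real \<Rightarrow> real^'n" where "\<phi> t = (\<chi> i. suminf (c i t))" for t
  have "continuous_on UNIV (\<lambda>t. suminf (c i t))" for i
  proof (rule uniform_limit_theorem)
    show "uniform_limit UNIV (\<lambda>n t. \<Sum>k<n. c i t k) (\<lambda>t. suminf (c i t)) sequentially"
    proof (rule Weierstrass_m_test)
      show "norm (c i t k) \<le> (1/2) ^ Suc k" for k t
        unfolding c_def by (simp add: plateau_bounds mult_left_le)
      show "summable (\<lambda>k. (1/2 :: real) ^ Suc k)"
        using summable_geometric[of "1/2 :: real"] by (subst summable_Suc_iff) simp
    qed
    show "\<forall>\<^sub>F n in sequentially. continuous_on UNIV (\<lambda>t. \<Sum>k<n. c i t k)"
      unfolding c_def by (intro always_eventually allI continuous_intros)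
  qed simp
  then have cont: "continuous_on UNIV \<phi>"
    unfolding \<phi>_def by (rule continuous_on_vec_lambda)
  have "c i (2 * real n + t) = c i t" for i n t
  proof
    fix k
    have "3 ^ (N * k + e i) * (2 * real n + t) = 2 * real (3 ^ (N * k + e i) * n) + 3 ^ (N * k + e i) * t"
      by (simp add: algebra_simps)
    then show "c i (2 * real n + t) k = c i t k"
      unfolding c_def by (simp only: plateau_period)
  qed
  then have per: "\<phi> (2 * real n + t) = \<phi> t" for n t
    by (simp add: \<phi>_def)
  have surj: "\<exists>t. 0 \<le> t \<and> t \<le> 1 \<and> \<phi> t = x" if x: "\<And>i. 0 \<le> x $ i \<and> x $ i \<le> 1" for x
  proof -
    have "\<exists>b::nat \<Rightarrow> nat. (\<forall>k. b k \<le> 1) \<and> (\<lambda>k. (1/2) ^ Suc k * real (b k)) sums (x $ i)" for i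
      using binary_expansion[of "x $ i"] x[of i] by metis
    then obtain b :: "'n \<Rightarrow> nat \<Rightarrow> nat" where b1: "\<And>i k. b i k \<le> 1"
      and b: "\<And>i. (\<lambda>k. (1/2) ^ Suc k * real (b i k)) sums (x $ i)"
      by metis
    \<comment> \<open>Undoes the interleaving: position \<open>m\<close> holds digit
      \<open>m div N\<close> of the coordinate numbered \<open>m mod N\<close>.\<close>
    define d where "d m = b (inv_into UNIV e (m mod N)) (m div N)" for m
    have d: "d (N * k + e i) = b i k" for i k
      using e_less[of i] e by (simp add: d_def bij_betw_def)
    obtain t where t: "0 \<le> t" "t \<le> 1" "\<And>m. plateau (3 ^ m * t) = real (d m)"
      using plateau_ternary[of d] b1 by (auto simp: d_def)
    have "c i t = (\<lambda>k. (1/2) ^ Suc k * real (b i k))" for i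
      by (rule ext) (simp only: c_def t(3) d)
    then have "suminf (c i t) = x $ i" for i
      using sums_unique[OF b[of i]] by simp
    then show ?thesis
      using t by (auto simp: \<phi>_def vec_eq_iff)
  qed
  from cont per surj show ?thesis
    by (rule that)
qed

text \<open>The factor \<open>h t = t - arccos (cos (pi * t)) / pi\<close> is constantly \<open>2 k\<close> on \<open>{2 k .. 2 k + 1}\<close>,
  so that on this interval \<open>h\<close> times a Schoenberg curve fills the cube of side \<open>4 k\<close>.\<close>

lemma curve_onto_space:
  obtains \<gamma> :: "real \<Rightarrow> real^'n::finite" where
    "continuous_on UNIV \<gamma>" "\<And>x. \<exists>t. 0 \<le> t \<and> t \<le> 2 * norm x + 5 \<and> \<gamma> t = x"
proof -
  obtain \<phi> :: "real \<Rightarrow> real^'n" where \<phi>: "continuous_on UNIV \<phi>"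
    and per: "\<And>n t. \<phi> (2 * real n + t) = \<phi> t"
    and surj: "\<And>x. (\<And>i. 0 \<le> x $ i \<and> x $ i \<le> 1) \<Longrightarrow> \<exists>t. 0 \<le> t \<and> t \<le> 1 \<and> \<phi> t = x"
    using schoenberg_curve by blast
  define h where "h t = t - arccos (cos (pi * t)) / pi" for t
  define \<gamma> :: "real \<Rightarrow> real^'n" where "\<gamma> t = h t *\<^sub>R (2 *\<^sub>R \<phi> t - 1)" for t
  have "continuous_on UNIV h"
    unfolding h_def by (intro continuous_intros) auto
  then have "continuous_on UNIV \<gamma>"
    unfolding \<gamma>_def by (intro continuous_intros \<phi>)
  moreover have "\<exists>t. 0 \<le> t \<and> t \<le> 2 * norm x + 5 \<and> \<gamma> t = x" for x
  proof -
    \<comment> \<open>The cube of side 4k contains \<open>x\<close>, and the parameter used is at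
      most 2k + 1, hence at most 2 \<open>norm x\<close> + 5. This linear growth is what tightness
      will rest on.\<close>
    define k where "k = nat \<lceil>norm x\<rceil> + 1"
    have k: "norm x \<le> real k" "real k \<le> norm x + 2" "0 < k"
      unfolding k_def using norm_ge_zero[of x] by (auto simp: le_nat_iff) linarith+
    \<comment> \<open>The solution of 2k (2u - 1) = x, taken coordinatewise.\<close>
    define u :: "real^'n" where "u = (\<chi> i. (x $ i / (2 * real k) + 1) / 2)"
    have "0 \<le> u $ i \<and> u $ i \<le> 1" for i
      using k component_le_norm_cart[of x i] by (auto simp: u_def field_simps)
    then obtain t where t: "0 \<le> t" "t \<le> 1" "\<phi> t = u"
      using surj by blast
    have "cos (pi * (2 * real k + t)) = cos (2 * real k * pi + pi * t)"
      by (simp add: algebra_simps)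
    also have "\<dots> = cos (pi * t)"
      by (simp add: cos_add)
    finally have "cos (pi * (2 * real k + t)) = cos (pi * t)" .
    then have "h (2 * real k + t) = 2 * real k"
      using t arccos_cos[of "pi * t"] by (simp add: h_def)
    then have "\<gamma> (2 * real k + t) = x"
      using k(3) by (simp add: \<gamma>_def per t u_def vec_eq_iff) (simp add: field_simps)
    then show ?thesis
      using t k by (intro exI[of _ "2 * real k + t"]) auto
  qed
  ultimately show ?thesis
    by (rule that)
qed

section \<open>Haviland's theorem\<close>

text \<open>Weak convergence handles the truncation of \<open>G\<close> to [-T,T]. The second moment
  bound makes the truncation error at most C/T, both along the sequence and for the limit measure;
  then T tends to infinity.\<close>

lemma weak_conv_integral_uniform_L2:
  fixes G :: "real \<Rightarrow> real"
  assumes M_seq: "\<And>n. real_distribution (M_seq n)" and M: "real_distribution M"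
    and conv: "weak_conv_m M_seq M"
    and cont: "continuous_on UNIV G"
    and int: "\<And>n. integrable (M_seq n) G" "\<And>n. integrable (M_seq n) (\<lambda>x. (G x)\<^sup>2)"
    and bound: "\<And>n. (\<integral>x. (G x)\<^sup>2 \<partial>M_seq n) \<le> C"
    and lim: "(\<lambda>n. \<integral>x. G x \<partial>M_seq n) \<longlonglongrightarrow> c"
  shows "integrable M G" "(\<integral>x. G x \<partial>M) = c"
proof -
  interpret M_seq: real_distribution "M_seq n" for n
    by (rule M_seq)
  interpret M: real_distribution M
    by (rule M)
  have cont_at: "isCont G x" for x
    using cont by (simp add: continuous_on_eq_continuous_at)
  have [measurable]: "G \<in> borel_measurable borel"
    using cont by (rule borel_measurable_continuous_onI)
  have weak: "(\<lambda>n. \<integral>x. f x \<partial>M_seq n) \<longlonglongrightarrow> (\<integral>x. f x \<partial>M)"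
    if "\<And>x. isCont f x" "\<And>x. \<bar>f x\<bar> \<le> B" for f :: "real \<Rightarrow> real" and B
    using that by (intro weak_conv_imp_integral_bdd_continuous_conv[OF M_seq M conv, of f B]) auto
  \<comment> \<open>Truncating the square of \<open>G\<close> at \<open>T\<close> gives a bounded
    continuous function, so the bound \<open>C\<close> passes to \<open>M\<close>; monotone
    convergence then removes the truncation.\<close>
  define P where "P T x = min (real T) ((G x)\<^sup>2)" for T :: nat and x
  have P_int: "integrable M (P T)" for T
    unfolding P_def by (rule M.integrable_const_bound[of _ "real T"]) auto
  have P_le: "(\<integral>x. P T x \<partial>M) \<le> C" for T
  proof (rule LIMSEQ_le_const2)
    show "(\<lambda>n. \<integral>x. P T x \<partial>M_seq n) \<longlonglongrightarrow> (\<integral>x. P T x \<partial>M)"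
      unfolding P_def by (rule weak[of _ "real T"]) (auto intro!: continuous_intros cont_at)
    have "(\<integral>x. P T x \<partial>M_seq n) \<le> (\<integral>x. (G x)\<^sup>2 \<partial>M_seq n)" for n
      unfolding P_def
      by (intro integral_mono int M_seq.integrable_const_bound[of _ "real T"]) auto
    then show "\<exists>N. \<forall>n\<ge>N. (\<integral>x. P T x \<partial>M_seq n) \<le> C"
      using bound by (meson order.trans)
  qed
  have P_mono: "P S x \<le> P T x" if "S \<le> T" for S T x
    using that by (auto simp: P_def)
  have P_lim: "(\<lambda>T. P T x) \<longlonglongrightarrow> (G x)\<^sup>2" for x
  proof (rule tendsto_eventually)
    obtain N :: nat where "(G x)\<^sup>2 \<le> real N"
      using real_arch_simple by blast
    then show "\<forall>\<^sub>F T in sequentially. P T x = (G x)\<^sup>2"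
      by (intro eventually_sequentiallyI[of N]) (auto simp: P_def)
  qed
  have "incseq (\<lambda>T. \<integral>x. P T x \<partial>M)"
    by (intro incseq_SucI integral_mono P_int P_mono) simp
  then obtain L where L: "(\<lambda>T. \<integral>x. P T x \<partial>M) \<longlonglongrightarrow> L"
    using P_le incseq_convergent[of "\<lambda>T. \<integral>x. P T x \<partial>M" C] by metis
  have P_props: "\<And>T. integrable M (P T)" "AE x in M. mono (\<lambda>T. P T x)"
    "AE x in M. (\<lambda>T. P T x) \<longlonglongrightarrow> (G x)\<^sup>2" "(\<lambda>x. (G x)\<^sup>2) \<in> borel_measurable M"
    using P_int P_mono P_lim by (auto simp: incseq_def)
  have G2: "integrable M (\<lambda>x. (G x)\<^sup>2)"
    by (rule integrable_monotone_convergence[OF P_props(1-3) L P_props(4)])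
  have G2_eq: "(\<integral>x. (G x)\<^sup>2 \<partial>M) = L"
    by (rule integral_monotone_convergence[OF P_props(1-3) L P_props(4)])
  have L_le: "L \<le> C"
    using L P_le by (intro LIMSEQ_le_const2) auto
  have abs_le: "\<bar>G x\<bar> \<le> 1 + (G x)\<^sup>2" for x
  proof -
    have "(\<bar>G x\<bar> - 1)\<^sup>2 = (G x)\<^sup>2 - 2 * \<bar>G x\<bar> + 1"
      by (simp add: power2_diff)
    then show ?thesis
      using zero_le_power2[of "\<bar>G x\<bar> - 1"] zero_le_power2[of "G x"] by linarith
  qed
  show GM: "integrable M G"
    by (rule Bochner_Integration.integrable_bound[of _ "\<lambda>x. 1 + (G x)\<^sup>2"])
       (use G2 abs_le in auto)
  define tr where "tr T x = max (- T) (min T (G x))" for T x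
  \<comment> \<open>Where truncation acts, |G| exceeds T, so |G| is at most G^2 / T.\<close>
  have tr: "\<bar>G x - tr T x\<bar> \<le> (G x)\<^sup>2 / T" if "T > 0" for T x
  proof (cases "\<bar>G x\<bar> \<le> T")
    case False
    then have "\<bar>G x - tr T x\<bar> \<le> \<bar>G x\<bar>"
      using that by (auto simp: tr_def)
    also have "\<dots> \<le> (G x)\<^sup>2 / T"
      using False that mult_left_mono[of T "\<bar>G x\<bar>" "\<bar>G x\<bar>"]
      by (simp add: field_simps power2_eq_square)
    finally show ?thesis .
  qed (use that in \<open>auto simp: tr_def\<close>)
  have tr_diff: "\<bar>(\<integral>x. G x \<partial>N) - (\<integral>x. tr T x \<partial>N)\<bar> \<le> C / T"
    if N: "real_distribution N" and "integrable N G" "integrable N (\<lambda>x. (G x)\<^sup>2)"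
      and le: "(\<integral>x. (G x)\<^sup>2 \<partial>N) \<le> C" and T: "T > 0" for N T
  proof -
    interpret N: real_distribution N by (rule N)
    have tr_int: "integrable N (tr T)"
      using T unfolding tr_def by (intro N.integrable_const_bound[of _ T]) auto
    have "\<bar>(\<integral>x. G x \<partial>N) - (\<integral>x. tr T x \<partial>N)\<bar> = \<bar>\<integral>x. G x - tr T x \<partial>N\<bar>"
      using that tr_int by simp
    also have "\<dots> \<le> (\<integral>x. (G x)\<^sup>2 / T \<partial>N)"
      using that tr_int tr[OF T] by (intro order.trans[OF integral_abs_bound] integral_mono) auto
    also have "\<dots> \<le> C / T"
      using le T by (simp add: divide_right_mono)
    finally show ?thesis .
  qed
  have close: "\<bar>(\<integral>x. G x \<partial>M) - c\<bar> \<le> 2 * C / T" if T: "T > 0" for T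
  proof -
    have "(\<lambda>n. \<integral>x. tr T x \<partial>M_seq n) \<longlonglongrightarrow> (\<integral>x. tr T x \<partial>M)"
      using T unfolding tr_def by (intro weak[of _ T]) (auto intro!: continuous_intros cont_at)
    then have "(\<lambda>n. \<bar>(\<integral>x. G x \<partial>M_seq n) - (\<integral>x. tr T x \<partial>M_seq n)\<bar>) \<longlonglongrightarrow> \<bar>c - (\<integral>x. tr T x \<partial>M)\<bar>"
      by (intro tendsto_intros lim)
    then have "\<bar>c - (\<integral>x. tr T x \<partial>M)\<bar> \<le> C / T"
      by (rule LIMSEQ_le_const2) (use tr_diff[OF M_seq int bound T] in auto)
    moreover have "\<bar>(\<integral>x. G x \<partial>M) - (\<integral>x. tr T x \<partial>M)\<bar> \<le> C / T"
      using L_le by (intro tr_diff M GM G2 T) (simp add: G2_eq)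
    ultimately show ?thesis
      by simp
  qed
  have "((\<lambda>T. 2 * C / T) \<longlongrightarrow> 0) at_top"
    by (intro tendsto_divide_0[OF tendsto_const] filterlim_at_top_imp_at_infinity filterlim_ident)
  then have "\<bar>(\<integral>x. G x \<partial>M) - c\<bar> \<le> 0"
    by (rule tendsto_lowerbound)
       (use close in \<open>auto intro!: eventually_mono[OF eventually_gt_at_top[of 0]]\<close>)
  then show "(\<integral>x. G x \<partial>M) = c"
    by simp
qed

text \<open>A half-space containing the moment vectors of all point masses on \<open>K\<close>
  amounts to a polynomial nonnegative on \<open>K\<close>, and positivity of the functional puts
  \<open>s\<close> in it too. So \<open>s\<close> cannot be separated from the convex set of such
  moment vectors.\<close>

lemma finite_moment_approximation:
  fixes K :: "(real^'n::finite) set"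
  assumes K: "K \<noteq> {}" and s0: "s 0 = 1" and pos: "\<And>f. f \<in> Pos K \<Longrightarrow> 0 \<le> pairing s f"
    and S: "finite S" and \<epsilon>: "\<epsilon> > 0"
  obtains p where "finite (set_pmf p)" "set_pmf p \<subseteq> K"
    "\<And>\<alpha>. \<alpha> \<in> S \<Longrightarrow> \<bar>measure_pmf.expectation p (mono_eval \<alpha>) - s \<alpha>\<bar> < \<epsilon>"
proof -
  define V where "V = (\<lambda>p \<alpha>. measure_pmf.expectation p (mono_eval \<alpha>)) ` {p :: (real^'n) pmf. finite (set_pmf p) \<and> set_pmf p \<subseteq> K}"
  have point: "(\<lambda>\<alpha>. mono_eval \<alpha> x) \<in> V" if "x \<in> K" for x
    unfolding V_def using that by (intro image_eqI[where x = "return_pmf x"]) auto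
  have "\<exists>w\<in>V. \<forall>\<alpha>\<in>S. \<bar>w \<alpha> - s \<alpha>\<bar> < \<epsilon>"
  proof (rule approximate_or_separate[OF S _ _ _ \<epsilon>])
    show "V \<noteq> {}"
      using K point by auto
  next
    fix u w and t :: real assume "u \<in> V" "w \<in> V" and t: "0 \<le> t" "t \<le> 1"
    then obtain p r where p: "finite (set_pmf p)" "set_pmf p \<subseteq> K" "u = (\<lambda>\<alpha>. measure_pmf.expectation p (mono_eval \<alpha>))"
      and r: "finite (set_pmf r)" "set_pmf r \<subseteq> K" "w = (\<lambda>\<alpha>. measure_pmf.expectation r (mono_eval \<alpha>))"
      by (auto simp: V_def)
    \<comment> \<open>The convex combination as a mixture: a biased coin chooses \<open>r\<close>
      with probability \<open>t\<close> and \<open>p\<close> otherwise.\<close>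
    let ?m = "bernoulli_pmf t \<bind> (\<lambda>b. if b then r else p)"
    have "measure_pmf.expectation ?m (mono_eval \<alpha>) = (1 - t) * u \<alpha> + t * w \<alpha>" for \<alpha>
      using t p r by (subst pmf_expectation_bind[of UNIV]) (auto simp: UNIV_bool)
    moreover have "finite (set_pmf ?m)" "set_pmf ?m \<subseteq> K"
      using p r by (auto split: if_splits)
    ultimately show "(\<lambda>\<alpha>. (1 - t) * u \<alpha> + t * w \<alpha>) \<in> V"
      unfolding V_def by (intro image_eqI[where x = ?m]) auto
  next
    fix a b assume *: "\<And>w. w \<in> V \<Longrightarrow> b \<le> (\<Sum>\<alpha>\<in>S. a \<alpha> * w \<alpha>)"
    \<comment> \<open>The inequality defining the half-space, read as a polynomial;
      \<open>s 0 = 1\<close> turns its constant term into -b.\<close>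
    let ?f = "(\<Sum>\<alpha>\<in>S. Poly_Mapping.single \<alpha> (a \<alpha>)) + Poly_Mapping.single 0 (- b)"
    have "?f \<in> Pos K"
      using *[OF point] by (simp add: Pos_def peval_add peval_sum)
    from pos[OF this] show "b \<le> (\<Sum>\<alpha>\<in>S. a \<alpha> * s \<alpha>)"
      by (simp add: pairing_add pairing_sum s0)
  qed
  then show ?thesis
    using that by (auto simp: V_def)
qed

section \<open>Regularity and growth of monomials\<close>

lemma continuous_on_mono_eval [continuous_intros]:
  fixes f :: "'a::topological_space \<Rightarrow> real^'n::finite"
  shows "continuous_on A f \<Longrightarrow> continuous_on A (\<lambda>t. mono_eval \<alpha> (f t))"
  unfolding mono_eval_def by (intro continuous_intros)

lemma borel_measurable_mono_eval [measurable]: "mono_eval \<alpha> \<in> borel_measurable borel"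
  using continuous_on_mono_eval[OF continuous_on_id] by (intro borel_measurable_continuous_onI) auto

text \<open>From (|x| - 1)^2 \<ge> 0. It controls the norm by second moments, and through them the
  curve parameter.\<close>

lemma norm_le_mono_eval: "2 * norm x \<le> 1 + (\<Sum>i\<in>UNIV. mono_eval (Poly_Mapping.single i 2) x)"
proof -
  have "mono_eval (Poly_Mapping.single i 2) x = (x $ i)\<^sup>2" for i
  proof -
    have "mono_eval (Poly_Mapping.single i 2) x = (\<Prod>j\<in>UNIV. if j = i then (x $ i)\<^sup>2 else 1)"
      unfolding mono_eval_def by (intro prod.cong) (auto simp: lookup_single)
    then show ?thesis
      by simp
  qed
  then have "(\<Sum>i\<in>UNIV. mono_eval (Poly_Mapping.single i 2) x) = (norm x)\<^sup>2"
    by (simp add: norm_vec_def L2_set_def sum_nonneg)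
  moreover have "(norm x - 1)\<^sup>2 = (norm x)\<^sup>2 - 2 * norm x + 1"
    by (simp add: power2_diff)
  ultimately show ?thesis
    using zero_le_power2[of "norm x - 1"] by linarith
qed

lemma finite_exp_bounded: "finite {\<alpha> :: 'n::finite \<Rightarrow>\<^sub>0 nat. \<forall>i. Poly_Mapping.lookup \<alpha> i \<le> d}"
proof -
  have "Poly_Mapping.lookup ` {\<alpha> :: 'n \<Rightarrow>\<^sub>0 nat. \<forall>i. Poly_Mapping.lookup \<alpha> i \<le> d} \<subseteq> PiE UNIV (\<lambda>_. {..d})"
    by auto
  then show ?thesis
    by (rule finite_imageD[OF finite_subset]) (auto simp: finite_PiE inj_on_def poly_mapping_eqI)
qed

text \<open>The representing measure is the image under the curve \<gamma> of a weak limit on the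
  line; the normalisation makes all approximants probability measures.\<close>

lemma moment_sequence_normalized:
  fixes K :: "(real^'n::finite) set"
  assumes K: "closed K" "K \<noteq> {}" and s0: "s 0 = 1" and pos: "\<And>f. f \<in> Pos K \<Longrightarrow> 0 \<le> pairing s f"
  shows "moment_sequence K s"
proof -
  \<comment> \<open>These finite sets exhaust all exponents, so an error below 1/(d+1) on
    \<open>S d\<close> makes every single moment converge.\<close>
  define S where "S d = {\<alpha> :: 'n \<Rightarrow>\<^sub>0 nat. \<forall>i. Poly_Mapping.lookup \<alpha> i \<le> d}" for d
  have "\<exists>p. finite (set_pmf p) \<and> set_pmf p \<subseteq> K \<and>
      (\<forall>\<alpha>\<in>S d. \<bar>measure_pmf.expectation p (mono_eval \<alpha>) - s \<alpha>\<bar> < inverse (real (Suc d)))" for d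
    by (rule finite_moment_approximation[OF K(2) s0 pos finite_exp_bounded, of "inverse (real (Suc d))" d])
       (auto simp: S_def)
  then obtain p where fin: "\<And>d. finite (set_pmf (p d))" and p_sub: "\<And>d. set_pmf (p d) \<subseteq> K"
    and approx: "\<And>d \<alpha>. \<alpha> \<in> S d \<Longrightarrow>
      \<bar>measure_pmf.expectation (p d) (mono_eval \<alpha>) - s \<alpha>\<bar> < inverse (real (Suc d))"
    by metis
  note int_p [simp] = integrable_measure_pmf_finite[OF fin]
  define E where "E \<alpha> d = measure_pmf.expectation (p d) (mono_eval \<alpha>)" for \<alpha> d
  have E_lim: "E \<alpha> \<longlonglongrightarrow> s \<alpha>" for \<alpha>
  proof -
    define N where "N = Max (range (Poly_Mapping.lookup \<alpha>))"
    have "\<alpha> \<in> S d" if "d \<ge> N" for d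
      using that Max_ge[of "range (Poly_Mapping.lookup \<alpha>)"] by (force simp: S_def N_def)
    then have "\<forall>\<^sub>F d in sequentially. norm (E \<alpha> d - s \<alpha>) \<le> inverse (real (Suc d))"
      unfolding E_def by (intro eventually_sequentiallyI[of N]) (auto intro!: less_imp_le approx simp del: of_nat_Suc)
    then have "(\<lambda>d. E \<alpha> d - s \<alpha>) \<longlonglongrightarrow> 0"
      by (rule Lim_null_comparison) (rule LIMSEQ_inverse_real_of_nat)
    then show ?thesis
      by (rule LIM_zero_cancel)
  qed
  have E_bound: "\<exists>C. \<forall>d. E \<alpha> d \<le> C" for \<alpha>
  proof -
    have "Bseq (E \<alpha>)"
      using E_lim by (intro convergent_imp_Bseq convergentI)
    then obtain C where "\<And>d. norm (E \<alpha> d) \<le> C"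
      using BseqE by blast
    then have "E \<alpha> d \<le> C" for d
      by (simp add: abs_le_iff)
    then show ?thesis
      by blast
  qed
  obtain \<gamma> :: "real \<Rightarrow> real^'n" where \<gamma>: "continuous_on UNIV \<gamma>"
    and "\<And>x. \<exists>t. 0 \<le> t \<and> t \<le> 2 * norm x + 5 \<and> \<gamma> t = x"
    using curve_onto_space by blast
  then obtain l where l: "\<And>x. 0 \<le> l x" "\<And>x. l x \<le> 2 * norm x + 5" "\<And>x. \<gamma> (l x) = x"
    by metis
  have [measurable]: "\<gamma> \<in> borel_measurable borel"
    using \<gamma> by (rule borel_measurable_continuous_onI)
  \<comment> \<open>\<open>l\<close> is a mere choice of preimages under \<gamma>; it is measurable
    because every set is measurable for \<open>measure_pmf\<close>. The image of
    \<open>\<mu> d\<close> under \<gamma> is again \<open>p d\<close>.\<close>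
  define \<mu> where "\<mu> d = distr (measure_pmf (p d)) borel l" for d
  have \<mu>: "real_distribution (\<mu> d)" for d
    unfolding \<mu>_def real_distribution_def real_distribution_axioms_def
    by (auto intro: measure_pmf.prob_space_distr)
  have \<mu>_int: "integrable (\<mu> d) f \<longleftrightarrow> True" if "f \<in> borel_measurable borel" for f :: "real \<Rightarrow> real" and d
    unfolding \<mu>_def using that by (subst integrable_distr_eq) auto
  have \<mu>_eq: "(\<integral>t. f t \<partial>\<mu> d) = measure_pmf.expectation (p d) (\<lambda>x. f (l x))"
    if "f \<in> borel_measurable borel" for f :: "real \<Rightarrow> real" and d
    unfolding \<mu>_def using that by (subst integral_distr) auto
  \<comment> \<open>Markov's inequality for the nonnegative function \<open>l\<close>, whose means
    are bounded through the convergent second moments.\<close>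
  have "tight \<mu>"
    unfolding tight_def
  proof (intro conjI allI impI \<mu>)
    fix \<epsilon> :: real assume \<epsilon>: "\<epsilon> > 0"
    obtain C where C: "\<forall>i d. E (Poly_Mapping.single i 2) d \<le> C i"
      using choice[of "\<lambda>i C. \<forall>d. E (Poly_Mapping.single i 2) d \<le> C"] E_bound by blast
    \<comment> \<open>The 6 is 5 from the bound on \<open>l\<close> plus 1 from
      \<open>norm_le_mono_eval\<close>.\<close>
    define B where "B = 6 + (\<Sum>i\<in>UNIV. \<bar>C i\<bar>)"
    have B: "B > 0"
      unfolding B_def by (intro add_pos_nonneg sum_nonneg) auto
    have mean: "measure_pmf.expectation (p d) l \<le> B" for d
    proof -
      have "l x \<le> 6 + (\<Sum>i\<in>UNIV. mono_eval (Poly_Mapping.single i 2) x)" for x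
        using l(2)[of x] norm_le_mono_eval[of x] by linarith
      then have "measure_pmf.expectation (p d) l \<le>
          measure_pmf.expectation (p d) (\<lambda>x. 6 + (\<Sum>i\<in>UNIV. mono_eval (Poly_Mapping.single i 2) x))"
        by (intro integral_mono) auto
      also have "\<dots> = 6 + (\<Sum>i\<in>UNIV. E (Poly_Mapping.single i 2) d)"
        by (simp add: E_def)
      also have "\<dots> \<le> B"
        unfolding B_def using C by (intro add_left_mono sum_mono) (meson abs_ge_self order_trans)
      finally show ?thesis .
    qed
    define c where "c = 2 * B / \<epsilon>"
    have c: "c > 0"
      using B \<epsilon> by (simp add: c_def)
    have "measure (\<mu> d) {-1<..c} > 1 - \<epsilon>" for d
    proof -
      have tail: "measure_pmf.prob (p d) {x. c \<le> l x} < \<epsilon>"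
      proof -
        have "measure_pmf.prob (p d) {x. c \<le> l x} \<le> measure_pmf.expectation (p d) l / c"
          using integral_Markov_inequality_measure[of "measure_pmf (p d)" l UNIV c] l(1) c by simp
        also have "\<dots> \<le> B / c"
          using mean c by (simp add: divide_right_mono)
        also have "\<dots> < \<epsilon>"
          using B \<epsilon> by (simp add: c_def field_simps)
        finally show ?thesis .
      qed
      have "1 - measure_pmf.prob (p d) {x. c \<le> l x} = measure_pmf.prob (p d) (UNIV - {x. c \<le> l x})"
        using measure_pmf.prob_compl[of "{x. c \<le> l x}" "p d"] by simp
      also have "\<dots> \<le> measure_pmf.prob (p d) {x. -1 < l x \<and> l x \<le> c}"
        using l(1) by (intro measure_pmf.finite_measure_mono) (auto simp: not_le less_le_trans[of "-1" 0])
      also have "\<dots> = measure (\<mu> d) {-1<..c}"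
        unfolding \<mu>_def by (subst measure_distr) (simp_all add: vimage_def)
      finally show ?thesis
        using tail by simp
    qed
    then show "\<exists>a b. a < b \<and> (\<forall>n. measure (\<mu> n) {a<..b} > 1 - \<epsilon>)"
      using c by (intro exI[of _ "-1"] exI[of _ c]) auto
  qed
  then obtain r M where r: "strict_mono (r :: nat \<Rightarrow> nat)" and M: "real_distribution M"
    and weak: "weak_conv_m (\<mu> \<circ> r) M"
    using tight_imp_convergent_subsubsequence[of \<mu> "\<lambda>x. x"] by (auto simp: strict_mono_def o_def)
  interpret M: real_distribution M
    by (rule M)
  have mom: "integrable M (\<lambda>t. mono_eval \<alpha> (\<gamma> t))" "(\<integral>t. mono_eval \<alpha> (\<gamma> t) \<partial>M) = s \<alpha>" for \<alpha>
  proof -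
    \<comment> \<open>The square of a monomial is the monomial with doubled exponent, whose
      approximate moments converge and are therefore bounded.\<close>
    obtain C where C: "\<And>d. E (\<alpha> + \<alpha>) d \<le> C"
      using E_bound by metis
    have sq: "(mono_eval \<alpha> x)\<^sup>2 = mono_eval (\<alpha> + \<alpha>) x" for x
      by (simp add: mono_eval_add power2_eq_square)
    have bound: "(\<integral>t. (mono_eval \<alpha> (\<gamma> t))\<^sup>2 \<partial>(\<mu> \<circ> r) n) \<le> C" for n
      using C[of "r n"] by (simp add: \<mu>_eq l(3) E_def sq)
    have "(\<lambda>n. \<integral>t. mono_eval \<alpha> (\<gamma> t) \<partial>(\<mu> \<circ> r) n) \<longlonglongrightarrow> s \<alpha>"
      using LIMSEQ_subseq_LIMSEQ[OF E_lim r, of \<alpha>] by (simp add: \<mu>_eq l(3) E_def o_def)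
    from weak_conv_integral_uniform_L2[OF _ M weak _ _ _ bound this]
    show "integrable M (\<lambda>t. mono_eval \<alpha> (\<gamma> t))" "(\<integral>t. mono_eval \<alpha> (\<gamma> t) \<partial>M) = s \<alpha>"
      by (auto simp: \<mu> \<mu>_int intro!: continuous_intros \<gamma>)
  qed
  have "AE t in M. \<gamma> t \<in> K"
  proof -
    \<comment> \<open>The capped distance to \<open>K\<close> along the curve is bounded and
      continuous, has integral 0 under every \<open>\<mu> d\<close>, and vanishes only where
      \<gamma> meets \<open>K\<close>.\<close>
    define f where "f t = min 1 (infdist (\<gamma> t) K)" for t
    have f_cont: "continuous_on UNIV f"
      unfolding f_def by (intro continuous_intros \<gamma>)
    then have f_meas [measurable]: "f \<in> borel_measurable borel"
      by (rule borel_measurable_continuous_onI)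
    have f_bd: "0 \<le> f t" "f t \<le> 1" for t
      by (auto simp: f_def infdist_nonneg)
    have "measure_pmf.expectation (p d) (\<lambda>x. f (l x)) = 0" for d
      using p_sub[of d] by (intro integral_eq_zero_AE AE_pmfI) (auto simp: f_def l(3) subset_iff)
    moreover have "(\<lambda>n. \<integral>t. f t \<partial>(\<mu> \<circ> r) n) \<longlonglongrightarrow> (\<integral>t. f t \<partial>M)"
      using f_bd f_cont
      by (intro weak_conv_imp_integral_bdd_continuous_conv[OF _ M weak, of f 1])
         (auto simp: \<mu> continuous_on_eq_continuous_at)
    ultimately have "(\<integral>t. f t \<partial>M) = 0"
      by (simp add: \<mu>_eq LIMSEQ_const_iff)
    then have "AE t in M. f t = 0"
      using f_bd by (subst (asm) integral_nonneg_eq_0_iff_AE) (auto intro!: M.integrable_const_bound[of _ 1])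
    then show ?thesis
      by eventually_elim (auto simp: f_def in_closed_iff_infdist_zero[OF K] min_def split: if_splits)
  qed
  then have "emeasure M {t \<in> space M. \<gamma> t \<notin> K} = 0"
    by (intro emeasure_eq_0_AE) simp
  moreover have "- K \<in> sets borel"
    using K(1) by (intro borel_open open_Compl)
  ultimately have null: "emeasure (distr M borel \<gamma>) (- K) = 0"
    by (subst emeasure_distr) (simp_all add: vimage_def)
  have "measure_support (distr M borel \<gamma>) \<subseteq> K"
    unfolding measure_support_def using K(1) null by (force simp: open_Compl)
  then have "representing_measure K s (distr M borel \<gamma>)"
    unfolding representing_measure_def using mom by (simp add: integrable_distr_eq integral_distr)
  then show ?thesis
    unfolding moment_sequence_def by blast
qed

text \<open>If \<open>s 0\<close> is positive, rescaling reduces to the normalised case. If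
  \<open>s 0\<close> is 0, positivity on squares forces \<open>s\<close> to vanish, and the null
  measure represents it.\<close>

theorem haviland:
  fixes K :: "(real^'n::finite) set"
  assumes K: "closed K" "K \<noteq> {}" and pos: "\<And>f. f \<in> Pos K \<Longrightarrow> 0 \<le> pairing s f"
  shows "moment_sequence K s"
proof (cases "s 0 = 0")
  case False
  define c where "c = s 0"
  have "0 \<le> s 0"
    using pos[of "Poly_Mapping.single 0 1"] by (simp add: Pos_def del: single_one)
  with False have c: "c > 0"
    by (simp add: c_def)
  have "moment_sequence K (\<lambda>\<alpha>. inverse c * s \<alpha>)"
    using c pos by (intro moment_sequence_normalized K) (auto simp: pairing_scale c_def)
  then obtain \<mu> where \<mu>: "representing_measure K (\<lambda>\<alpha>. inverse c * s \<alpha>) \<mu>"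
    by (auto simp: moment_sequence_def)
  let ?\<nu> = "density \<mu> (\<lambda>_. ennreal c)"
  have sets: "sets \<mu> = sets borel"
    using \<mu> by (simp add: representing_measure_def)
  have int: "integrable \<mu> (mono_eval \<alpha>)" for \<alpha>
    using \<mu> by (simp add: representing_measure_def)
  have "measure_support ?\<nu> = measure_support \<mu>"
    using c sets by (auto simp: measure_support_def emeasure_density_const ennreal_zero_less_mult_iff)
  moreover have "integrable ?\<nu> (mono_eval \<alpha>)" "s \<alpha> = (\<integral>x. mono_eval \<alpha> x \<partial>?\<nu>)" for \<alpha>
  proof -
    have "inverse c * s \<alpha> = (\<integral>x. mono_eval \<alpha> x \<partial>\<mu>)"
      using \<mu> by (simp add: representing_measure_def)
    then have "s \<alpha> = c * (\<integral>x. mono_eval \<alpha> x \<partial>\<mu>)"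
      using c by (metis mult.assoc mult_1 right_inverse order_less_irrefl)
    also have "\<dots> = (\<integral>x. mono_eval \<alpha> x \<partial>?\<nu>)"
      using c borel_measurable_integrable[OF int[of \<alpha>]] by (subst integral_density) auto
    finally show "s \<alpha> = (\<integral>x. mono_eval \<alpha> x \<partial>?\<nu>)" .
    show "integrable ?\<nu> (mono_eval \<alpha>)"
      using c int[of \<alpha>] borel_measurable_integrable[OF int[of \<alpha>]]
      by (subst integrable_density) auto
  qed
  ultimately have "representing_measure K s ?\<nu>"
    using \<mu> sets by (simp add: representing_measure_def)
  then show ?thesis
    by (auto simp: moment_sequence_def)
next
  case True
  have "s \<alpha> = 0" for \<alpha>
  proof -
    \<comment> \<open>Apply positivity to the square of t plus a monomial. The t^2 term is lost
      because \<open>s 0\<close> is 0, and an affine function of t that stays nonnegative has slope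
      0.\<close>
    have quad: "0 \<le> 2 * t * s \<alpha> + s (\<alpha> + \<alpha>)" for t
    proof -
      let ?f = "Poly_Mapping.single 0 (t\<^sup>2) + Poly_Mapping.single \<alpha> (2 * t) + Poly_Mapping.single (\<alpha> + \<alpha>) 1"
      have "peval ?f x = (t + mono_eval \<alpha> x)\<^sup>2" for x
        by (simp add: peval_add mono_eval_add power2_eq_square algebra_simps)
      then have "0 \<le> pairing s ?f"
        by (intro pos) (simp add: Pos_def)
      then show ?thesis
        by (simp add: pairing_add True)
    qed
    show ?thesis
    proof (rule ccontr)
      assume "s \<alpha> \<noteq> 0"
      \<comment> \<open>At this \<open>t\<close> the affine function takes the value -1.\<close>
      then show False
        using quad[of "- (s (\<alpha> + \<alpha>) + 1) / (2 * s \<alpha>)"] by (simp add: field_simps)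
    qed
  qed
  then have "representing_measure K s (null_measure borel)"
    by (auto simp: representing_measure_def measure_support_def)
  then show ?thesis
    by (auto simp: moment_sequence_def)
qed

section \<open>Positivity preservers\<close>

text \<open>The complement of the support is the union of all open null sets; by Lindelof's theorem
  countably many of them suffice, so the union is null.\<close>

lemma AE_measure_support:
  fixes \<mu> :: "'a::second_countable_topology measure"
  assumes sets: "sets \<mu> = sets borel"
  shows "AE x in \<mu>. x \<in> measure_support \<mu>"
proof -
  have [measurable_cong]: "sets \<mu> = sets borel" and space: "space \<mu> = UNIV"
    using sets sets_eq_imp_space_eq[OF sets] by auto
  define \<F> where "\<F> = {U. open U \<and> emeasure \<mu> U = 0}"
  obtain \<F>' where \<F>': "\<F>' \<subseteq> \<F>" "countable \<F>'" "\<Union>\<F>' = \<Union>\<F>"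
    by (rule Lindelof[of \<F>]) (auto simp: \<F>_def)
  have "AE x in \<mu>. \<forall>U\<in>\<F>'. x \<notin> U"
  proof (subst AE_ball_countable[OF \<F>'(2)], rule ballI)
    fix U assume "U \<in> \<F>'"
    with \<F>'(1) have "open U" "emeasure \<mu> U = 0"
      by (auto simp: \<F>_def)
    then show "AE x in \<mu>. x \<notin> U"
      by (intro AE_I[of _ _ U]) (auto simp: sets)
  qed
  then show ?thesis
  proof eventually_elim
    case (elim x)
    then have "x \<notin> \<Union>\<F>"
      using \<F>'(3) by blast
    then show ?case
      by (auto simp: measure_support_def \<F>_def zero_less_iff_neq_zero)
  qed
qed

lemma pairing_eq_integral:
  assumes "representing_measure L s \<mu>"
  shows "pairing s f = (\<integral>x. peval f x \<partial>\<mu>)"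
  using assms by (simp add: representing_measure_def pairing_def peval_def)

text \<open>The easy direction of Haviland's theorem: the measure is carried by its support, which
  lies in \<open>K\<close>.\<close>

lemma pairing_nonneg:
  assumes \<mu>: "representing_measure K s \<mu>" and f: "f \<in> Pos K"
  shows "0 \<le> pairing s f"
  unfolding pairing_eq_integral[OF \<mu>]
proof (rule integral_nonneg_AE)
  have "AE x in \<mu>. x \<in> measure_support \<mu>"
    using \<mu> by (intro AE_measure_support) (simp add: representing_measure_def)
  then show "AE x in \<mu>. 0 \<le> peval f x"
    by eventually_elim (use \<mu> f in \<open>auto simp: representing_measure_def Pos_def\<close>)
qed

text \<open>The moments follow by integrating \<open>mono_eval_translate\<close> term by term. The
  support moves along because translation is a homeomorphism.\<close>

lemma representing_measure_translate:
  fixes y :: "real^'n::finite"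
  assumes \<mu>: "representing_measure L s \<mu>"
  shows "representing_measure ((\<lambda>x. x + y) ` L) (shift_seq y s) (distr \<mu> borel (\<lambda>x. x + y))"
proof -
  have sets [measurable_cong]: "sets \<mu> = sets borel" and supp: "measure_support \<mu> \<subseteq> L"
    and int: "\<And>\<alpha>. integrable \<mu> (mono_eval \<alpha>)" and s: "\<And>\<alpha>. s \<alpha> = (\<integral>x. mono_eval \<alpha> x \<partial>\<mu>)"
    using \<mu> by (auto simp: representing_measure_def)
  have mono: "integrable \<mu> (\<lambda>x. mono_eval \<alpha> (x + y))"
      "(\<integral>x. mono_eval \<alpha> (x + y) \<partial>\<mu>) = shift_seq y s \<alpha>" for \<alpha>
    unfolding mono_eval_translate shift_seq_def using int by (simp_all add: s)
  have "measure_support (distr \<mu> borel (\<lambda>x. x + y)) \<subseteq> (\<lambda>x. x + y) ` L"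
  proof
    fix z assume z: "z \<in> measure_support (distr \<mu> borel (\<lambda>x. x + y))"
    have "z - y \<in> measure_support \<mu>"
      unfolding measure_support_def
    proof (intro CollectI allI impI)
      fix U assume U: "open U \<and> z - y \<in> U"
      let ?U = "(\<lambda>x. x - y) -` U"
      have "open ?U"
        using U by (intro open_vimage continuous_intros) auto
      with z U have "0 < emeasure (distr \<mu> borel (\<lambda>x. x + y)) ?U"
        by (auto simp: measure_support_def)
      also have "\<dots> = emeasure \<mu> U"
        using \<open>open ?U\<close> sets_eq_imp_space_eq[OF sets]
        by (subst emeasure_distr) (auto simp: vimage_def)
      finally show "0 < emeasure \<mu> U" .
    qed
    then show "z \<in> (\<lambda>x. x + y) ` L"
      using supp by (intro image_eqI[where x = "z - y"]) auto
  qed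
  then show ?thesis
    unfolding representing_measure_def using mono
    by (simp add: integrable_distr_eq integral_distr)
qed

text \<open>The constant coefficients yield the shifted sequence of \<mu>, whose Riesz functional is
  integration against the translate of \<mu> by \<open>y\<close>.\<close>

lemma diff_op_const_eq_integral:
  assumes \<mu>: "representing_measure L (\<lambda>\<alpha>. mfact \<alpha> * c \<alpha>) \<mu>"
  shows "peval (diff_op (\<lambda>\<alpha>. Poly_Mapping.single 0 (c \<alpha>)) f) y = (\<integral>x. peval f (x + y) \<partial>\<mu>)"
proof -
  have sets [measurable_cong]: "sets \<mu> = sets borel"
    using \<mu> by (simp add: representing_measure_def)
  have [measurable]: "peval f \<in> borel_measurable borel"
    unfolding peval_def
    by (intro borel_measurable_continuous_onI continuous_intros)
  have "peval (diff_op (\<lambda>\<alpha>. Poly_Mapping.single 0 (c \<alpha>)) f) y = pairing (shift_seq y (\<lambda>\<alpha>. mfact \<alpha> * c \<alpha>)) f"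
    by (simp add: peval_diff_op)
  also have "\<dots> = (\<integral>x. peval f (x + y) \<partial>\<mu>)"
    by (simp add: pairing_eq_integral[OF representing_measure_translate[OF \<mu>]] integral_distr)
  finally show ?thesis .
qed

text \<open>The equivalence is proved for each \<open>y\<close> separately: translation by
  \<open>y\<close> and by \<open>- y\<close> passes between K - y and K, and on K Haviland's theorem
  and its converse apply.\<close>

lemma positivity_preserver_iff_moment_sequence:
  fixes K :: "(real^'n::finite) set"
  assumes K: "closed K" "K \<noteq> {}"
  shows "positivity_preserver K (diff_op q) \<longleftrightarrow>
    (\<forall>y\<in>K. moment_sequence ((\<lambda>x. x - y) ` K) (\<lambda>\<alpha>. mfact \<alpha> * peval (q \<alpha>) y))"
proof -
  have "(\<forall>f\<in>Pos K. 0 \<le> peval (diff_op q f) y) \<longleftrightarrow>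
      moment_sequence ((\<lambda>x. x - y) ` K) (\<lambda>\<alpha>. mfact \<alpha> * peval (q \<alpha>) y)" for y
  proof -
    define s where "s = (\<lambda>\<alpha>. mfact \<alpha> * peval (q \<alpha>) y)"
    have "moment_sequence K (shift_seq y s)" if "moment_sequence ((\<lambda>x. x - y) ` K) s"
      using that representing_measure_translate[of "(\<lambda>x. x - y) ` K" s _ y]
      by (auto simp: moment_sequence_def image_image)
    moreover have "moment_sequence ((\<lambda>x. x - y) ` K) s" if "moment_sequence K (shift_seq y s)"
      using that representing_measure_translate[of K "shift_seq y s" _ "- y"]
      by (auto simp: moment_sequence_def shift_seq_shift_seq)
    moreover have "moment_sequence K (shift_seq y s) \<longleftrightarrow> (\<forall>f\<in>Pos K. 0 \<le> pairing (shift_seq y s) f)"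
      using haviland[OF K] pairing_nonneg by (auto simp: moment_sequence_def)
    ultimately show ?thesis
      by (auto simp: peval_diff_op s_def)
  qed
  then show ?thesis
    unfolding positivity_preserver_def by (auto simp: Pos_def)
qed

theorem theorem4p5:
  fixes K :: "(real^'n::finite) set"
    and q :: "('n \<Rightarrow>\<^sub>0 nat) \<Rightarrow> 'n mpoly"
  assumes "closed K" and "K \<noteq> {}"
  shows "(positivity_preserver K (diff_op q) \<longleftrightarrow>
            (\<forall>y\<in>K. moment_sequence ((\<lambda>x. x - y) ` K) (\<lambda>\<alpha>. mfact \<alpha> * peval (q \<alpha>) y)))
       \<and> (positivity_preserver K (diff_op q) \<longrightarrow>
            (\<forall>y\<in>K. \<forall>\<mu>. representing_measure ((\<lambda>x. x - y) ` K) (\<lambda>\<alpha>. mfact \<alpha> * peval (q \<alpha>) y) \<mu> \<longrightarrow>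
               (\<forall>f. peval (diff_op (\<lambda>\<alpha>. Poly_Mapping.single 0 (peval (q \<alpha>) y)) f) y
                      = (\<integral>x. peval f (x + y) \<partial>\<mu>))))"
  using positivity_preserver_iff_moment_sequence[OF assms, of q]
  by (auto intro: diff_op_const_eq_integral)

end
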